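(* Let $r>0$, $H>0$ and consider the unrestricted two-dimensional Newton problem of minimal resistance $$R[u(\cdot)]=\int_0^r\frac{1}{1+u(x)^2}\,dx\longrightarrow\min,\qquad \dot y(x)=u(x),\quad u(x)\in\mathbb{R},\quad y(0)=0,\quad y(r)=H.$$ If $H>\frac{\sqrt3}{3}r$, then the function $y(x)=\frac{H}{r}x$, $x\in[0,r]$ (with control $u\equiv\frac{H}{r}$), is a local minimizer of the problem. If $H\le\frac{\sqrt3}{3}r$, the problem has no solution, i.e. it has no local minimizer.
   Context: Admissible pairs $(y(\cdot),u(\cdot))$: $y:[0,r]\to\mathbb{R}$ is continuous with piecewise continuous derivative, $u=\dot y$ is piecewise continuous on $[0,r]$ with real values, and $y(0)=0$, $y(r)=H$. An admissible pair $(\hat y(\cdot),\hat u(\cdot))$ is a local minimizer (in the weak sense) if there exists $\varepsilon>0$ such that $R[\hat u(\cdot)]\le R[u(\cdot)]$ for every admissible pair $(y(\cdot),u(\cdot))$ with $\sup_{x\in[0,r]}|u(x)-\hat u(x)|<\varepsilon$ (the supremum being taken over points where both controls are defined). *)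

theory Defs
  imports "HOL-Analysis.Analysis"
begin

definition piecewise_continuous_on_interval :: "real \<Rightarrow> real \<Rightarrow> (real \<Rightarrow> real) \<Rightarrow> bool" where
  "piecewise_continuous_on_interval a b u \<longleftrightarrow>
     (\<exists>S. finite S \<and> continuous_on ({a..b} - S) u) \<and>
     (\<forall>x\<in>{a<..b}. \<exists>l. (u \<longlongrightarrow> l) (at_left x)) \<and>
     (\<forall>x\<in>{a..<b}. \<exists>l. (u \<longlongrightarrow> l) (at_right x))"

text \<open>
  Controls are total functions here, but a control is regarded as defined only at those points of
  \<open>[0, r]\<close> where \<open>u\<close> is the derivative of \<open>y\<close> (one-sided at the end points). For an admissible
  pair these are all but finitely many points; the values of \<open>u\<close> elsewhere carry no meaning.
\<close>
definition control_domain :: "real \<Rightarrow> (real \<Rightarrow> real) \<Rightarrow> (real \<Rightarrow> real) \<Rightarrow> real set" where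
  "control_domain r y u = {x \<in> {0..r}. (y has_real_derivative u x) (at x within {0..r})}"

definition admissible :: "real \<Rightarrow> real \<Rightarrow> (real \<Rightarrow> real) \<Rightarrow> (real \<Rightarrow> real) \<Rightarrow> bool" where
  "admissible r H y u \<longleftrightarrow>
     continuous_on {0..r} y \<and>
     piecewise_continuous_on_interval 0 r u \<and>
     finite ({0..r} - control_domain r y u) \<and>
     y 0 = 0 \<and> y r = H"

definition resistance :: "real \<Rightarrow> (real \<Rightarrow> real) \<Rightarrow> real" where
  "resistance r u = integral {0..r} (\<lambda>x. 1 / (1 + (u x)\<^sup>2))"

text \<open>The supremum is taken in \<^typ>\<open>ereal\<close>, so that it is meaningful without a boundedness proof.\<close>
definition control_dist ::
  "real \<Rightarrow> (real \<Rightarrow> real) \<Rightarrow> (real \<Rightarrow> real) \<Rightarrow> (real \<Rightarrow> real) \<Rightarrow> (real \<Rightarrow> real) \<Rightarrow> ereal" where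
  "control_dist r y u y' u' =
     (SUP x\<in>control_domain r y u \<inter> control_domain r y' u'. ereal \<bar>u x - u' x\<bar>)"

definition local_minimizer :: "real \<Rightarrow> real \<Rightarrow> (real \<Rightarrow> real) \<Rightarrow> (real \<Rightarrow> real) \<Rightarrow> bool" where
  "local_minimizer r H y' u' \<longleftrightarrow>
     admissible r H y' u' \<and>
     (\<exists>\<epsilon>>0. \<forall>y u. admissible r H y u \<longrightarrow> control_dist r y u y' u' < ereal \<epsilon> \<longrightarrow>
        resistance r u' \<le> resistance r u)"

end

theory Submission
  imports Defs
begin

text \<open>
  Write \<open>f v = 1 / (1 + v\<^sup>2)\<close> for the integrand, called \<open>drag\<close> below. Its second derivative has
  the sign of \<open>3 v\<^sup>2 - 1\<close>, so the slope \<open>sqrt 3 / 3\<close> separates the slopes near which \<open>f\<close> is convex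
  from those near which it is concave. All competitors have the same mean slope, because an
  admissible control has integral \<open>H\<close> (\<open>control_has_integral\<close>).

  If \<open>c = H / r > sqrt 3 / 3\<close>, then \<open>f\<close> lies on or above its tangent at \<open>c\<close> on a neighbourhood of \<open>c\<close>
  (\<open>drag_minus_tangent\<close>). Along a control with values in that neighbourhood, the linear
  part of the tangent integrates to zero, and what remains is the resistance of the straight line
  (\<open>line_local_minimizer\<close>).

  If \<open>H \<le> sqrt 3 / 3 * r\<close>, any admissible control can be improved by an arbitrarily small change.
  The change raises the slope by \<open>d\<close> on a short interval and lowers it by \<open>d\<close> on another
  interval of the same length, which leaves the end point of the curve in place. If both intervals
  shrink to points with slopes \<open>p\<close> and \<open>q\<close>, such an exchange pays as soon as
  \<open>f (p + d) + f (q - d) < f p + f q\<close> (\<open>two_point_exchange\<close>). There are always slopes for which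
  this holds with every \<open>d > 0\<close>. The mean slope is at most \<open>sqrt 3 / 3\<close>, so some slope \<open>q\<close> is at
  most \<open>sqrt 3 / 3\<close>. If \<open>q \<ge> 0\<close>, then \<open>p = q\<close> works: spreading a slope symmetrically
  lowers the sum of the drags (\<open>drag_symmetric_sum_less\<close>), and this includes the inflection slope
  itself, which is why the borderline case \<open>H = sqrt 3 / 3 * r\<close> needs no separate argument. If
  \<open>q < 0\<close>, then there is also a slope \<open>p > 0\<close> since \<open>H > 0\<close>, and the exchange makes both slopes
  steeper, which lowers both drags.
\<close>

section \<open>The integrand\<close>

definition drag :: "real \<Rightarrow> real" where
  "drag v = 1 / (1 + v\<^sup>2)"

lemma resistance_eq: "resistance r u = integral {0..r} (\<lambda>x. drag (u x))"
  by (simp add: resistance_def drag_def)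

lemma one_plus_sq_pos: "0 < 1 + (v::real)\<^sup>2"
  by (simp add: add_pos_nonneg)

lemma continuous_on_drag: "continuous_on A drag"
  unfolding drag_def
  by (intro continuous_intros ballI) (metis one_plus_sq_pos less_irrefl)

lemma isCont_drag: "isCont drag x"
  using continuous_on_drag[of UNIV] by (simp add: continuous_on_eq_continuous_at)

lemma drag_less: "v\<^sup>2 < w\<^sup>2 \<Longrightarrow> drag w < drag v"
  unfolding drag_def using one_plus_sq_pos[of v] by (intro divide_strict_left_mono) (auto simp: add_pos_nonneg)

text \<open>
  The deviation of the integrand from its tangent at \<open>c\<close> has the sign of \<open>2 c v + c\<^sup>2 - 1\<close>. At
  \<open>v = c\<close> this is \<open>3 c\<^sup>2 - 1\<close>, and being linear in \<open>v\<close> it yields an explicit neighbourhood of \<open>c\<close>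
  on which the tangent is a lower bound.
\<close>

lemma drag_minus_tangent:
  "drag v - drag c + 2 * c / (1 + c\<^sup>2)\<^sup>2 * (v - c) =
     (v - c)\<^sup>2 * (2 * c * v + c\<^sup>2 - 1) / ((1 + v\<^sup>2) * (1 + c\<^sup>2)\<^sup>2)"
proof -
  have "1 + v\<^sup>2 \<noteq> 0" "1 + c\<^sup>2 \<noteq> 0"
    using one_plus_sq_pos[of v] one_plus_sq_pos[of c] by auto
  then show ?thesis
    unfolding drag_def by (simp add: divide_simps) algebra
qed

text \<open>
  A spread \<open>d\<close> lowers the sum exactly when \<open>3 c\<^sup>2 < 1 + d\<^sup>2\<close>. The term \<open>d\<^sup>2\<close> is a fourth-order
  effect, and it makes the inequality strict at the inflection point \<open>3 c\<^sup>2 = 1\<close>, where the second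
  derivative gives no information.
\<close>

lemma drag_symmetric_sum_less:
  assumes "d \<noteq> 0" "3 * c\<^sup>2 < 1 + d\<^sup>2"
  shows "drag (c + d) + drag (c - d) < drag c + drag c"
proof -
  have pos: "0 < 1 + (c + d)\<^sup>2" "0 < 1 + (c - d)\<^sup>2" "0 < 1 + c\<^sup>2"
    by (auto intro: one_plus_sq_pos)
  have "drag c + drag c - (drag (c + d) + drag (c - d)) =
     2 * d\<^sup>2 * (1 + d\<^sup>2 - 3 * c\<^sup>2) / ((1 + c\<^sup>2) * (1 + (c + d)\<^sup>2) * (1 + (c - d)\<^sup>2))"
    using pos unfolding drag_def by (simp add: divide_simps) algebra
  moreover have "0 < 2 * d\<^sup>2 * (1 + d\<^sup>2 - 3 * c\<^sup>2) / ((1 + c\<^sup>2) * (1 + (c + d)\<^sup>2) * (1 + (c - d)\<^sup>2))"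
    using pos assms by (intro divide_pos_pos mult_pos_pos) auto
  ultimately show ?thesis by linarith
qed

section \<open>Integrals and piecewise continuous functions\<close>

lemma has_integral_le_off_finite:
  fixes f g :: "real \<Rightarrow> real"
  assumes "finite S" "(f has_integral i) A" "(g has_integral j) A"
    and le: "\<And>x. x \<in> A - S \<Longrightarrow> f x \<le> g x"
  shows "i \<le> j"
proof -
  have "((\<lambda>x. if x \<in> S then g x else f x) has_integral i) A"
    by (rule has_integral_spike_finite[OF assms(1) _ assms(2)]) auto
  then show ?thesis
    by (rule has_integral_le[OF _ assms(3)]) (use le in auto)
qed

lemma has_integral_indicator_interval:
  fixes a b :: real
  assumes "0 \<le> a" "a \<le> b" "b \<le> r"
  shows "((indicator {a<..<b} :: real \<Rightarrow> real) has_integral (b - a)) {0..r}"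
proof -
  have "((\<lambda>x. if x \<in> {a..b} then 1 else 0 :: real) has_integral (b - a)) {0..r}"
    using assms has_integral_const_real[of "1::real" a b]
    by (subst has_integral_restrict) auto
  then show ?thesis
    by (rule has_integral_spike_finite[of "{a, b}", rotated 2]) (auto simp: indicator_def)
qed

lemma piecewise_continuous_add:
  assumes "piecewise_continuous_on_interval a b u" "piecewise_continuous_on_interval a b v"
  shows "piecewise_continuous_on_interval a b (\<lambda>x. u x + v x)"
proof -
  obtain S T where "finite S" "continuous_on ({a..b} - S) u" "finite T" "continuous_on ({a..b} - T) v"
    using assms unfolding piecewise_continuous_on_interval_def by blast
  then have "finite (S \<union> T)" "continuous_on ({a..b} - (S \<union> T)) (\<lambda>x. u x + v x)"
    by (auto intro!: continuous_on_add elim: continuous_on_subset)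
  moreover have "\<exists>l. ((\<lambda>x. u x + v x) \<longlongrightarrow> l) (at_left x)" if x: "x \<in> {a<..b}" for x
  proof -
    obtain l m where "(u \<longlongrightarrow> l) (at_left x)" "(v \<longlongrightarrow> m) (at_left x)"
      using assms x unfolding piecewise_continuous_on_interval_def by blast
    then have "((\<lambda>x. u x + v x) \<longlongrightarrow> l + m) (at_left x)"
      by (rule tendsto_add)
    then show ?thesis ..
  qed
  moreover have "\<exists>l. ((\<lambda>x. u x + v x) \<longlongrightarrow> l) (at_right x)" if x: "x \<in> {a..<b}" for x
  proof -
    obtain l m where "(u \<longlongrightarrow> l) (at_right x)" "(v \<longlongrightarrow> m) (at_right x)"
      using assms x unfolding piecewise_continuous_on_interval_def by blast
    then have "((\<lambda>x. u x + v x) \<longlongrightarrow> l + m) (at_right x)"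
      by (rule tendsto_add)
    then show ?thesis ..
  qed
  ultimately show ?thesis
    unfolding piecewise_continuous_on_interval_def by blast
qed

lemma piecewise_continuous_step:
  "piecewise_continuous_on_interval a b (\<lambda>x. k * indicator {p<..<q} x)"
proof -
  let ?s = "\<lambda>x. k * indicator {p<..<q} x :: real"
  have "isCont ?s x" if x: "x \<notin> {p, q}" for x
  proof -
    have "\<forall>\<^sub>F y in nhds x. indicator {p<..<q} y = (indicator {p<..<q} x :: real)"
    proof -
      consider "x < p" | "q < x" | "p < x" "x < q"
        using x by (metis insertCI linorder_neqE)
      then show ?thesis
      proof cases
        case 1
        then show ?thesis
          using eventually_nhds_in_open[of "{..<p}" x] by (auto elim!: eventually_mono)
      next
        case 2
        then show ?thesis
          using eventually_nhds_in_open[of "{q<..}" x] by (auto elim!: eventually_mono)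
      next
        case 3
        then show ?thesis
          using eventually_nhds_in_open[of "{p<..<q}" x] by (auto elim!: eventually_mono)
      qed
    qed
    then show ?thesis
      by (subst isCont_cong[where g = "\<lambda>_. k * indicator {p<..<q} x"]) (auto elim!: eventually_mono)
  qed
  then have "continuous_on ({a..b} - {p, q}) ?s"
    by (intro continuous_at_imp_continuous_on) auto
  moreover have "\<exists>l. (?s \<longlongrightarrow> l) (at_left x)" for x
  proof -
    obtain w where "w < x" and w: "\<And>y. w < y \<Longrightarrow> y < x \<Longrightarrow> ?s y = ?s ((w + x) / 2)"
    proof -
      consider "x \<le> p" | "p < x" "x \<le> q" | "p < x" "q < x" by linarith
      then show thesis
      proof cases
        case 1 then show thesis by (intro that[of "x - 1"]) auto
      next
        case 2 then show thesis by (intro that[of p]) auto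
      next
        case 3 then show thesis by (intro that[of q]) auto
      qed
    qed
    then have "\<forall>\<^sub>F y in at_left x. ?s y = ?s ((w + x) / 2)"
      by (intro eventually_at_leftI[OF w \<open>w < x\<close>]) auto
    then show ?thesis by (intro exI) (rule tendsto_eventually)
  qed
  moreover have "\<exists>l. (?s \<longlongrightarrow> l) (at_right x)" for x
  proof -
    obtain w where "x < w" and w: "\<And>y. x < y \<Longrightarrow> y < w \<Longrightarrow> ?s y = ?s ((w + x) / 2)"
    proof -
      consider "q \<le> x" | "x < q" "p \<le> x" | "x < q" "x < p" by linarith
      then show thesis
      proof cases
        case 1 then show thesis by (intro that[of "x + 1"]) auto
      next
        case 2 then show thesis by (intro that[of q]) auto
      next
        case 3 then show thesis by (intro that[of p]) auto
      qed
    qed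
    then have "\<forall>\<^sub>F y in at_right x. ?s y = ?s ((w + x) / 2)"
      by (intro eventually_at_rightI[OF w \<open>x < w\<close>]) auto
    then show ?thesis by (intro exI) (rule tendsto_eventually)
  qed
  ultimately show ?thesis
    unfolding piecewise_continuous_on_interval_def
    by (intro conjI exI[of _ "{p, q}"]) auto
qed

text \<open>A continuous primitive of the indicator of \<open>{p<..<q}\<close>, constant outside that interval.\<close>

definition ramp :: "real \<Rightarrow> real \<Rightarrow> real \<Rightarrow> real" where
  "ramp p q x = min (max (x - p) 0) (q - p)"

lemma continuous_on_ramp: "continuous_on A (ramp p q)"
  unfolding ramp_def by (intro continuous_intros)

lemma ramp_has_derivative:
  assumes "p \<le> q" "x \<notin> {p, q}"
  shows "(ramp p q has_real_derivative indicator {p<..<q} x) (at x within A)"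
proof -
  consider "x < p" | "q < x" | "p < x" "x < q"
    using assms(2) by (metis insertCI linorder_neqE)
  then have "(ramp p q has_real_derivative indicator {p<..<q} x) (at x)"
  proof cases
    case 1
    have "((\<lambda>x. 0) has_real_derivative indicator {p<..<q} x) (at x)"
      using 1 by simp
    then show ?thesis
      by (rule has_field_derivative_transform_within_open[where S = "{..<p}"])
        (use 1 assms in \<open>auto simp: ramp_def\<close>)
  next
    case 2
    have "((\<lambda>x. q - p) has_real_derivative indicator {p<..<q} x) (at x)"
      using 2 by simp
    then show ?thesis
      by (rule has_field_derivative_transform_within_open[where S = "{q<..}"])
        (use 2 assms in \<open>auto simp: ramp_def\<close>)
  next
    case 3
    have "((\<lambda>x. x - p) has_real_derivative indicator {p<..<q} x) (at x)"
      using 3 by (auto intro!: derivative_eq_intros)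
    then show ?thesis
      by (rule has_field_derivative_transform_within_open[where S = "{p<..<q}"])
        (use 3 assms in \<open>auto simp: ramp_def\<close>)
  qed
  then show ?thesis by (rule has_field_derivative_at_within)
qed

section \<open>Admissible pairs\<close>

lemma admissible_control_continuous:
  assumes "admissible r H y u"
  obtains S where "finite S" "continuous_on ({0..r} - S) u"
  using assms unfolding admissible_def piecewise_continuous_on_interval_def by blast

lemma isCont_off_finite:
  fixes u :: "real \<Rightarrow> real"
  assumes "finite S" "continuous_on ({0..r} - S) u" "x \<in> {0<..<r} - S"
  shows "isCont u x"
proof -
  have "open ({0<..<r} - S)"
    using assms(1) by (intro open_Diff finite_imp_closed) auto
  moreover have "continuous_on ({0<..<r} - S) u"
    using assms(2) by (rule continuous_on_subset) auto
  ultimately show ?thesis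
    using assms(3) by (simp add: continuous_on_eq_continuous_at)
qed

lemma control_has_integral:
  assumes "admissible r H y u" "0 \<le> r"
  shows "(u has_integral H) {0..r}"
proof -
  have "(u has_integral (y r - y 0)) {0..r}"
  proof (rule fundamental_theorem_of_calculus_interior_strong)
    show "finite ({0..r} - control_domain r y u)" "continuous_on {0..r} y"
      using assms(1) by (auto simp: admissible_def)
    show "(y has_vector_derivative u x) (at x)"
      if "x \<in> {0<..<r} - ({0..r} - control_domain r y u)" for x
      using that at_within_Icc_at[of 0 x r]
      by (auto simp: control_domain_def has_real_derivative_iff_has_vector_derivative)
  qed (use assms in auto)
  then show ?thesis using assms(1) by (simp add: admissible_def)
qed

lemma resistance_has_integral:
  assumes "admissible r H y u"
  shows "((\<lambda>x. drag (u x)) has_integral resistance r u) {0..r}"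
proof -
  obtain S where S: "finite S" "continuous_on ({0..r} - S) u"
    by (rule admissible_control_continuous[OF assms])
  have meas: "{0..r} - S \<in> sets lebesgue"
    using S(1) by (intro sets.Diff) (auto intro: lmeasurable_cbox simp: finite_imp_closed)
  have "(\<lambda>x. drag (u x)) integrable_on ({0..r} - S)"
  proof (rule measurable_bounded_by_integrable_imp_integrable_real)
    show "(\<lambda>x. drag (u x)) \<in> borel_measurable (lebesgue_on ({0..r} - S))"
      using meas S continuous_on_compose2[OF continuous_on_drag[of UNIV] S(2)]
      by (intro continuous_imp_measurable_on_sets_lebesgue) auto
    show "(\<lambda>x. 1::real) integrable_on ({0..r} - S)"
      by (rule integrable_spike_set[of _ "{0..r}"])
        (auto intro: negligible_subset[OF negligible_finite[OF S(1)]])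
    show "\<bar>drag (u x)\<bar> \<le> 1" for x
      using one_plus_sq_pos[of "u x"] by (simp add: drag_def divide_le_eq_1)
  qed (use meas in auto)
  then have "(\<lambda>x. drag (u x)) integrable_on {0..r}"
    by (rule integrable_spike_set)
      (auto intro: negligible_subset[OF negligible_finite[OF S(1)]])
  then show ?thesis
    by (simp add: resistance_eq integrable_integral)
qed

section \<open>Steep lines are local minimizers\<close>

lemma line_admissible:
  assumes "0 < r"
  shows "admissible r H (\<lambda>x. H / r * x) (\<lambda>x. H / r)"
    and "control_domain r (\<lambda>x. H / r * x) (\<lambda>x. H / r) = {0..r}"
proof -
  show *: "control_domain r (\<lambda>x. H / r * x) (\<lambda>x. H / r) = {0..r}"
    unfolding control_domain_def by (auto intro!: derivative_eq_intros)
  show "admissible r H (\<lambda>x. H / r * x) (\<lambda>x. H / r)"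
    using assms unfolding admissible_def piecewise_continuous_on_interval_def *
    by (auto intro!: continuous_intros exI[of _ "H / r"] exI[of _ "{}"])
qed

lemma line_local_minimizer:
  assumes "0 < r" "0 < H" "sqrt 3 / 3 * r < H"
  shows "local_minimizer r H (\<lambda>x. H / r * x) (\<lambda>x. H / r)"
proof -
  define c where "c = H / r"
  have c: "0 < c" "sqrt 3 / 3 < c"
    using assms by (auto simp: c_def field_simps)
  have "(sqrt 3 / 3)\<^sup>2 < c\<^sup>2"
    using c by (intro power_strict_mono) auto
  then have c2: "1 < 3 * c\<^sup>2"
    by (simp add: power_divide)
  \<comment> \<open>the distance from \<open>c\<close> to the zero of \<open>2 * c * v + c\<^sup>2 - 1\<close>, as a function of \<open>v\<close>\<close>
  define e where "e = (3 * c\<^sup>2 - 1) / (2 * c)"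
  have e: "0 < e"
    using c c2 by (simp add: e_def)
  have tangent: "drag c - 2 * c / (1 + c\<^sup>2)\<^sup>2 * (v - c) \<le> drag v" if "\<bar>v - c\<bar> < e" for v
  proof -
    have "2 * c * (c - v) \<le> 2 * c * e"
      using that c by (intro mult_left_mono) auto
    also have "2 * c * e = 3 * c\<^sup>2 - 1"
      using c by (simp add: e_def)
    finally have "0 \<le> 2 * c * v + c\<^sup>2 - 1"
      by (simp add: algebra_simps power2_eq_square)
    then have "0 \<le> (v - c)\<^sup>2 * (2 * c * v + c\<^sup>2 - 1) / ((1 + v\<^sup>2) * (1 + c\<^sup>2)\<^sup>2)"
      using one_plus_sq_pos[of v] one_plus_sq_pos[of c]
      by (intro divide_nonneg_nonneg mult_nonneg_nonneg) auto
    then show ?thesis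
      using drag_minus_tangent[of v c] by linarith
  qed
  have "resistance r (\<lambda>x. c) \<le> resistance r u"
    if adm: "admissible r H y u" and dist: "control_dist r y u (\<lambda>x. c * x) (\<lambda>x. c) < ereal e" for y u
  proof -
    have close: "\<bar>u x - c\<bar> < e" if "x \<in> control_domain r y u" for x
    proof -
      have "x \<in> control_domain r y u \<inter> control_domain r (\<lambda>x. c * x) (\<lambda>x. c)"
        using that line_admissible(2)[OF assms(1), of H]
        unfolding c_def[symmetric] by (auto simp: control_domain_def)
      then have "ereal \<bar>u x - c\<bar> \<le> control_dist r y u (\<lambda>x. c * x) (\<lambda>x. c)"
        unfolding control_dist_def by (rule SUP_upper)
      then show ?thesis
        using dist by (metis le_less_trans ereal_less_eq(3) less_ereal.simps(1))
    qed
    have const: "((\<lambda>x. k) has_integral r * k) {0..r}" for k :: real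
      using assms(1) has_integral_const_real[of k 0 r] by simp
    have "((\<lambda>x. u x - c) has_integral H - r * c) {0..r}"
      using assms(1) by (intro has_integral_diff control_has_integral[OF adm] const) auto
    then have "((\<lambda>x. u x - c) has_integral 0) {0..r}"
      using assms(1) by (simp add: c_def)
    then have "((\<lambda>x. drag c - 2 * c / (1 + c\<^sup>2)\<^sup>2 * (u x - c)) has_integral
         r * drag c - 2 * c / (1 + c\<^sup>2)\<^sup>2 * 0) {0..r}"
      by (intro has_integral_diff has_integral_mult_right const)
    moreover have "finite ({0..r} - control_domain r y u)"
      using adm by (simp add: admissible_def)
    ultimately have "r * drag c - 2 * c / (1 + c\<^sup>2)\<^sup>2 * 0 \<le> resistance r u"
      using tangent close
      by (intro has_integral_le_off_finite[OF _ _ resistance_has_integral[OF adm]]) auto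
    then show ?thesis
      using assms(1) by (simp add: resistance_eq)
  qed
  then show ?thesis
    using line_admissible(1)[OF assms(1)] e unfolding local_minimizer_def c_def by blast
qed

section \<open>Exchanging slope between two short intervals\<close>

text \<open>
  The two intervals have equal length \<open>h\<close>, so the two ramps end at the same height and their
  contributions to the value at \<open>r\<close> cancel.
\<close>

lemma admissible_perturb:
  assumes "admissible r H y u" "0 \<le> r"
    and "0 \<le> a" "0 \<le> h" "a + h \<le> r" "0 \<le> b" "b + h \<le> r"
  shows "admissible r H (\<lambda>x. y x + (d * ramp a (a + h) x - d * ramp b (b + h) x))
           (\<lambda>x. u x + (d * indicator {a<..<a + h} x + (- d) * indicator {b<..<b + h} x))"
    (is "admissible r H ?z ?v")
proof -
  have "control_domain r y u - {a, a + h, b, b + h} \<subseteq> control_domain r ?z ?v"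
    unfolding control_domain_def using assms
    by (auto intro!: derivative_eq_intros ramp_has_derivative)
  then have "{0..r} - control_domain r ?z ?v \<subseteq> ({0..r} - control_domain r y u) \<union> {a, a + h, b, b + h}"
    by blast
  moreover have "finite (({0..r} - control_domain r y u) \<union> {a, a + h, b, b + h})"
    using assms(1) by (simp add: admissible_def)
  ultimately have "finite ({0..r} - control_domain r ?z ?v)"
    by (rule finite_subset)
  moreover have "?z 0 = 0" "?z r = H"
    using assms by (auto simp: admissible_def ramp_def)
  moreover have "continuous_on {0..r} ?z"
    using assms(1) by (intro continuous_intros continuous_on_ramp) (simp add: admissible_def)
  moreover have "piecewise_continuous_on_interval 0 r ?v"
    using assms(1)
    by (intro piecewise_continuous_add piecewise_continuous_step) (simp add: admissible_def)
  ultimately show ?thesis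
    unfolding admissible_def by blast
qed

text \<open>
  The strict inequality at the two points survives, by continuity of the control there, on short
  intervals next to them, and integrating over these intervals gives a strictly smaller resistance.
  The points may coincide: one interval is attached to the right of \<open>x1\<close> and the other to the
  left of \<open>x2\<close>, so they are disjoint even then.
\<close>

lemma two_point_exchange:
  assumes adm: "admissible r H y u"
    and S: "finite S" "continuous_on ({0..r} - S) u"
    and x: "x1 \<in> {0<..<r} - S" "x2 \<in> {0<..<r} - S"
    and gain: "drag (u x1 + d) + drag (u x2 - d) < drag (u x1) + drag (u x2)"
  shows "\<exists>z v. admissible r H z v \<and> control_dist r z v y u \<le> ereal \<bar>d\<bar> \<and>
           resistance r v < resistance r u"
proof -
  \<comment> \<open>a third of the gain: each of the two intervals may lose up to \<open>\<eta>\<close> to the variation of \<open>u\<close>\<close>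
  define \<eta> where "\<eta> = (drag (u x1) + drag (u x2) - drag (u x1 + d) - drag (u x2 - d)) / 3"
  have \<eta>: "0 < \<eta>"
    using gain by (simp add: \<eta>_def)
  define A where "A = drag (u x1 + d) - drag (u x1) + \<eta>"
  define B where "B = drag (u x2 - d) - drag (u x2) + \<eta>"
  have AB: "A + B < 0"
    using gain by (simp add: A_def B_def \<eta>_def field_simps)
  have loc: "\<exists>e>0. \<forall>t. \<bar>t - x\<bar> < e \<longrightarrow>
      drag (u t + k) - drag (u t) < drag (u x + k) - drag (u x) + \<eta>"
    if "x \<in> {0<..<r} - S" for x k
  proof -
    have "isCont (\<lambda>t. drag (u t + k) - drag (u t)) x"
      using isCont_off_finite[OF S that] by (intro continuous_intros isCont_o2[OF _ isCont_drag])
    then have "((\<lambda>t. drag (u t + k) - drag (u t)) \<longlongrightarrow> drag (u x + k) - drag (u x)) (nhds x)"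
      using tendsto_at_iff_tendsto_nhds[of "\<lambda>t. drag (u t + k) - drag (u t)" x]
      by (simp add: isCont_def)
    then have "\<forall>\<^sub>F t in nhds x. drag (u t + k) - drag (u t) < drag (u x + k) - drag (u x) + \<eta>"
      using \<eta> by (auto intro: order_tendstoD(2))
    then show ?thesis
      by (auto simp: eventually_nhds_metric dist_real_def)
  qed
  obtain e1 where e1: "0 < e1" "\<And>t. \<bar>t - x1\<bar> < e1 \<Longrightarrow> drag (u t + d) - drag (u t) < A"
    using loc[OF x(1), of d] unfolding A_def by auto
  obtain e2 where e2: "0 < e2" "\<And>t. \<bar>t - x2\<bar> < e2 \<Longrightarrow> drag (u t - d) - drag (u t) < B"
    using loc[OF x(2), of "- d"] unfolding B_def by auto
  \<comment> \<open>only for \<open>x1 < x2\<close> do the intervals approach each other; the value \<open>1\<close> is arbitrary\<close>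
  define gap where "gap = (if x1 < x2 then (x2 - x1) / 2 else 1)"
  define h where "h = Min {e1, e2, r - x1, x2, gap}"
  have h: "0 < h" "h \<le> e1" "h \<le> e2" "h \<le> r - x1" "h \<le> x2" "h \<le> gap"
    using x e1(1) e2(1) by (auto simp: h_def gap_def)
  define b where "b = x2 - h"
  let ?I = "{x1<..<x1 + h}" and ?J = "{b<..<b + h}"
  have disj: "t \<notin> ?J" if "t \<in> ?I" for t
    using that h by (auto simp: b_def gap_def split: if_splits)
  define z where "z = (\<lambda>x. y x + (d * ramp x1 (x1 + h) x - d * ramp b (b + h) x))"
  define v where "v = (\<lambda>x. u x + (d * indicator ?I x + (- d) * indicator ?J x))"
  have adm': "admissible r H z v"
    unfolding z_def v_def using x h by (intro admissible_perturb adm) (auto simp: b_def)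
  have "\<bar>v t - u t\<bar> \<le> \<bar>d\<bar>" for t
    using disj[of t] by (auto simp: v_def indicator_def)
  then have "control_dist r z v y u \<le> ereal \<bar>d\<bar>"
    unfolding control_dist_def by (intro SUP_least) simp
  moreover have "resistance r v \<le> resistance r u + (A * (x1 + h - x1) + B * (b + h - b))"
  proof (rule has_integral_le[OF resistance_has_integral[OF adm']])
    show "((\<lambda>t. drag (u t) + (A * indicator ?I t + B * indicator ?J t)) has_integral
        resistance r u + (A * (x1 + h - x1) + B * (b + h - b))) {0..r}"
      using x h
      by (intro has_integral_add has_integral_mult_right has_integral_indicator_interval
          resistance_has_integral[OF adm]) (auto simp: b_def)
    show "drag (v t) \<le> drag (u t) + (A * indicator ?I t + B * indicator ?J t)" for t
    proof -
      consider "t \<in> ?I" | "t \<in> ?J" | "t \<notin> ?I" "t \<notin> ?J" by blast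
      then show ?thesis
      proof cases
        case 1
        then show ?thesis
          using disj[OF 1] e1(2)[of t] h by (auto simp: v_def)
      next
        case 2
        then have "t \<notin> ?I" using disj by blast
        then show ?thesis
          using 2 e2(2)[of t] h by (simp add: v_def b_def)
      next
        case 3
        then show ?thesis by (simp add: v_def)
      qed
    qed
  qed
  moreover have "A * (x1 + h - x1) + B * (b + h - b) < 0"
    using mult_neg_pos[OF AB h(1)] by (simp add: algebra_simps)
  ultimately show ?thesis
    using adm' by (intro exI[of _ z] exI[of _ v]) auto
qed

section \<open>Flat problems have no local minimizer\<close>

text \<open>
  If the control exceeded \<open>k\<close> at all regular points, it would exceed \<open>k\<close> by a fixed amount on a
  whole interval, by continuity at one of them, and its integral would be larger than \<open>k * r\<close>.
\<close>

lemma exists_control_le_average: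
  assumes adm: "admissible r H y u" and "0 < r" "H \<le> k * r"
    and S: "finite S" "continuous_on ({0..r} - S) u"
  shows "\<exists>x\<in>{0<..<r} - S. u x \<le> k"
proof (rule ccontr)
  assume "\<not> ?thesis"
  then have gt: "k < u x" if "x \<in> {0<..<r} - S" for x
    using that by force
  have "infinite ({0<..<r} - S)"
    using S(1) \<open>0 < r\<close> by (intro Diff_infinite_finite) auto
  then obtain x where x: "x \<in> {0<..<r} - S"
    by (metis finite.emptyI equals0I)
  define m where "m = (u x - k) / 2"
  have m: "0 < m"
    using gt[OF x] by (simp add: m_def)
  have "(u \<longlongrightarrow> u x) (nhds x)"
    using isCont_off_finite[OF S x] by (simp add: isCont_def tendsto_at_iff_tendsto_nhds)
  then have "\<forall>\<^sub>F t in nhds x. k + m < u t"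
    by (rule order_tendstoD(1)) (use m in \<open>simp add: m_def field_simps\<close>)
  then obtain e where e: "0 < e" "\<And>t. \<bar>t - x\<bar> < e \<Longrightarrow> k + m < u t"
    by (auto simp: eventually_nhds_metric dist_real_def)
  define h where "h = min e (r - x)"
  have h: "0 < h" "h \<le> e" "x + h \<le> r"
    using e x by (auto simp: h_def)
  have "(r - 0) *\<^sub>R k + m * (x + h - x) \<le> H"
  proof (rule has_integral_le_off_finite)
    show "finite (S \<union> {0, r})" using S by simp
    show "(u has_integral H) {0..r}"
      using adm \<open>0 < r\<close> by (intro control_has_integral) auto
    show "((\<lambda>t. k + m * indicator {x<..<x + h} t) has_integral
        (r - 0) *\<^sub>R k + m * (x + h - x)) {0..r}"
      using x h \<open>0 < r\<close> has_integral_const_real[of k 0 r]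
      by (intro has_integral_add has_integral_mult_right has_integral_indicator_interval) auto
    show "k + m * indicator {x<..<x + h} t \<le> u t" if "t \<in> {0..r} - (S \<union> {0, r})" for t
    proof (cases "t \<in> {x<..<x + h}")
      case True
      then show ?thesis using e(2)[of t] h by simp
    next
      case False
      have "k < u t" by (rule gt) (use that in auto)
      then show ?thesis using False by simp
    qed
  qed
  then show False
    using \<open>H \<le> k * r\<close> mult_pos_pos[OF m h(1)] by (simp add: algebra_simps)
qed

lemma exists_control_pos:
  assumes adm: "admissible r H y u" and "0 < r" "0 < H" "finite S"
  shows "\<exists>x\<in>{0<..<r} - S. 0 < u x"
proof (rule ccontr)
  assume "\<not> ?thesis"
  then have nonpos: "u x \<le> 0" if "x \<in> {0<..<r} - S" for x
    using that by (meson not_le)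
  have "H \<le> 0"
  proof (rule has_integral_le_off_finite)
    show "finite (S \<union> {0, r})" using \<open>finite S\<close> by simp
    show "(u has_integral H) {0..r}"
      using adm \<open>0 < r\<close> by (intro control_has_integral) auto
    show "((\<lambda>x. 0) has_integral (0::real)) {0..r}"
      by (rule has_integral_0)
    show "u x \<le> 0" if "x \<in> {0..r} - (S \<union> {0, r})" for x
      by (rule nonpos) (use that in auto)
  qed
  then show False using \<open>0 < H\<close> by simp
qed

text \<open>
  Optimality rules out every gainful exchange with the admissible step \<open>d\<close>, whereas the control
  takes slopes, two equal ones or two of opposite sign, at which an exchange is gainful.
\<close>

lemma no_local_minimizer:
  assumes "0 < r" "0 < H" "H \<le> sqrt 3 / 3 * r"
  shows "\<not> local_minimizer r H y u"
proof
  assume "local_minimizer r H y u"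
  then obtain \<epsilon> where adm: "admissible r H y u" and "0 < \<epsilon>"
    and opt: "\<And>z v. admissible r H z v \<Longrightarrow> control_dist r z v y u < ereal \<epsilon> \<Longrightarrow>
                resistance r u \<le> resistance r v"
    unfolding local_minimizer_def by blast
  define d where "d = \<epsilon> / 2"
  have d: "0 < d" "d < \<epsilon>"
    using \<open>0 < \<epsilon>\<close> by (auto simp: d_def)
  obtain S where S: "finite S" "continuous_on ({0..r} - S) u"
    by (rule admissible_control_continuous[OF adm])
  have no_gain: "drag (u x1) + drag (u x2) \<le> drag (u x1 + d) + drag (u x2 - d)"
    if x12: "x1 \<in> {0<..<r} - S" "x2 \<in> {0<..<r} - S" for x1 x2
  proof (rule ccontr)
    assume "\<not> ?thesis"
    then obtain z v where zv: "admissible r H z v" "control_dist r z v y u \<le> ereal \<bar>d\<bar>"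
        "resistance r v < resistance r u"
      using two_point_exchange[OF adm S x12, of d] by force
    have "control_dist r z v y u < ereal \<epsilon>"
      using zv(2) d by (auto intro: le_less_trans)
    then show False
      using opt[OF zv(1)] zv(3) by simp
  qed
  obtain x2 where x2: "x2 \<in> {0<..<r} - S" "u x2 \<le> sqrt 3 / 3"
    using exists_control_le_average[OF adm assms(1,3) S] by blast
  show False
  proof (cases "0 \<le> u x2")
    case True
    then have "(u x2)\<^sup>2 \<le> (sqrt 3 / 3)\<^sup>2"
      using x2(2) by (intro power_mono)
    then have "3 * (u x2)\<^sup>2 \<le> 1"
      by (simp add: power_divide)
    then have "3 * (u x2)\<^sup>2 < 1 + d\<^sup>2"
      using zero_less_power[OF d(1), of 2] by linarith
    then show False
      using drag_symmetric_sum_less[of d "u x2"] no_gain[OF x2(1) x2(1)] d(1) by simp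
  next
    case False
    obtain x1 where x1: "x1 \<in> {0<..<r} - S" "0 < u x1"
      using exists_control_pos[OF adm assms(1,2) S(1)] by blast
    have "(u x1)\<^sup>2 < (u x1 + d)\<^sup>2"
      using x1(2) d(1) by (intro power_strict_mono) auto
    moreover have "(- u x2)\<^sup>2 < (- u x2 + d)\<^sup>2"
      using False d(1) by (intro power_strict_mono) auto
    then have "(u x2)\<^sup>2 < (u x2 - d)\<^sup>2"
      by (simp add: power2_commute)
    ultimately show False
      using no_gain[OF x1(1) x2(1)] drag_less[of "u x1" "u x1 + d"] drag_less[of "u x2" "u x2 - d"]
      by linarith
  qed
qed

theorem theorem6:
  fixes r H :: real
  assumes "r > 0" and "H > 0"
  shows "(H > sqrt 3 / 3 * r \<longrightarrow> local_minimizer r H (\<lambda>x. H / r * x) (\<lambda>x. H / r)) \<and>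
         (H \<le> sqrt 3 / 3 * r \<longrightarrow> \<not> (\<exists>y u. local_minimizer r H y u))"
proof (intro conjI impI notI)
  assume "H > sqrt 3 / 3 * r"
  then show "local_minimizer r H (\<lambda>x. H / r * x) (\<lambda>x. H / r)"
    by (rule line_local_minimizer[OF assms])
next
  assume "H \<le> sqrt 3 / 3 * r" and "\<exists>y u. local_minimizer r H y u"
  then show False
    using no_local_minimizer[OF assms] by metis
qed

end
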